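(* Let $S$ be an $n\times n$ stochastic matrix that is a direct sum of $k\ge 2$ irreducible stochastic matrices. Let $T=S+E$ be another $n\times n$ stochastic matrix, and set $\epsilon=\|E\|_\infty/2$. Then $I-T$ has $k$ singular values (counted with multiplicity) that are bounded above by $2\epsilon\sqrt{n}$.
   Context: All matrices are real. A matrix in $\mathbb{R}^{n\times n}$ is stochastic if its entries are nonnegative and each row sums to $1$. The direct sum of square matrices is $A\oplus B=\mathrm{diag}(A,B)$ (block diagonal). $\|\cdot\|_\infty$ is the matrix norm induced by the $\ell_\infty$ vector norm, i.e. the maximum absolute row sum. $I$ is the $n\times n$ identity matrix. *)

theory Defs
  imports
    "Jordan_Normal_Form.Char_Poly"
    "HOL-Combinatorics.Permutations"
begin

definition stochastic_mat :: "real mat \<Rightarrow> bool" where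
  "stochastic_mat A \<longleftrightarrow> square_mat A \<and>
     (\<forall>i < dim_row A. \<forall>j < dim_col A. A $$ (i, j) \<ge> 0) \<and>
     (\<forall>i < dim_row A. (\<Sum>j < dim_col A. A $$ (i, j)) = 1)"

(* A square matrix is reducible if a simultaneous permutation of its rows and columns brings it
   to block upper triangular form with two nonempty square diagonal blocks. In particular every
   1 x 1 matrix is irreducible; the empty matrix is excluded. *)
definition reducible_mat :: "'a :: zero mat \<Rightarrow> bool" where
  "reducible_mat A \<longleftrightarrow>
     (let n = dim_row A in
       \<exists>p r X Y Z. p permutes {..<n} \<and> 0 < r \<and> r < n \<and>
         X \<in> carrier_mat r r \<and> Y \<in> carrier_mat r (n - r) \<and> Z \<in> carrier_mat (n - r) (n - r) \<and>
         mat n n (\<lambda>(i, j). A $$ (p i, p j)) = four_block_mat X Y (0\<^sub>m (n - r) r) Z)"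

definition irreducible_mat :: "'a :: zero mat \<Rightarrow> bool" where
  "irreducible_mat A \<longleftrightarrow> square_mat A \<and> 0 < dim_row A \<and> \<not> reducible_mat A"

(* The element 0 only matters for the empty vector. *)
definition linf_norm_vec :: "real vec \<Rightarrow> real" where
  "linf_norm_vec v = Max (insert 0 ((\<lambda>i. \<bar>v $ i\<bar>) ` {..<dim_vec v}))"

definition linf_norm_mat :: "real mat \<Rightarrow> real" where
  "linf_norm_mat A =
     (SUP x \<in> {x \<in> carrier_vec (dim_col A). linf_norm_vec x \<le> 1}. linf_norm_vec (A *\<^sub>v x))"

lemma linf_norm_vec_le_iff:
  "linf_norm_vec v \<le> c \<longleftrightarrow> 0 \<le> c \<and> (\<forall>i < dim_vec v. \<bar>v $ i\<bar> \<le> c)"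
  unfolding linf_norm_vec_def by (subst Max_le_iff) auto

lemma abs_index_le_linf_norm_vec: "i < dim_vec v \<Longrightarrow> \<bar>v $ i\<bar> \<le> linf_norm_vec v"
  using linf_norm_vec_le_iff[of v "linf_norm_vec v"] by simp

lemma linf_norm_mat_eq_max_row_sum:
  "linf_norm_mat A = Max (insert 0 ((\<lambda>i. \<Sum>j < dim_col A. \<bar>A $$ (i, j)\<bar>) ` {..<dim_row A}))"
proof -
  define R where "R = (\<lambda>i. \<Sum>j < dim_col A. \<bar>A $$ (i, j)\<bar>)"
  define M where "M = Max (insert 0 (R ` {..<dim_row A}))"
  define U where "U = {x \<in> carrier_vec (dim_col A). linf_norm_vec x \<le> 1}"
  have M0: "0 \<le> M" by (simp add: M_def)
  have RM: "R i \<le> M" if "i < dim_row A" for i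
    using that by (simp add: M_def)
  have idx: "(A *\<^sub>v x) $ i = (\<Sum>j < dim_col A. A $$ (i, j) * x $ j)"
    if "x \<in> carrier_vec (dim_col A)" "i < dim_row A" for x i
    using that by (auto simp: scalar_prod_def lessThan_atLeast0 intro!: sum.cong)
  have le: "linf_norm_vec (A *\<^sub>v x) \<le> M" if x: "x \<in> U" for x
  proof -
    have "\<bar>(A *\<^sub>v x) $ i\<bar> \<le> M" if i: "i < dim_row A" for i
    proof -
      have "\<bar>(A *\<^sub>v x) $ i\<bar> \<le> (\<Sum>j < dim_col A. \<bar>A $$ (i, j) * x $ j\<bar>)"
        using x i by (subst idx) (auto simp: U_def)
      also have "\<dots> \<le> R i"
        unfolding R_def
        using x by (intro sum_mono) (auto simp: abs_mult U_def linf_norm_vec_le_iff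
          intro!: mult_left_le)
      finally show ?thesis using RM[OF i] by simp
    qed
    thus ?thesis using M0 by (simp add: linf_norm_vec_le_iff)
  qed
  have zero: "0\<^sub>v (dim_col A) \<in> U"
    by (simp add: U_def linf_norm_vec_le_iff)
  have bdd: "bdd_above ((\<lambda>x. linf_norm_vec (A *\<^sub>v x)) ` U)"
    using le by (intro bdd_aboveI2)
  have upper: "linf_norm_mat A \<le> M"
    unfolding linf_norm_mat_def U_def[symmetric] using zero le by (intro cSUP_least) auto
  have up: "linf_norm_vec (A *\<^sub>v x) \<le> linf_norm_mat A" if "x \<in> U" for x
    unfolding linf_norm_mat_def U_def[symmetric] using that bdd by (intro cSUP_upper)
  have nonneg: "0 \<le> linf_norm_mat A"
    using up[OF zero] linf_norm_vec_le_iff[of "A *\<^sub>v 0\<^sub>v (dim_col A)" "linf_norm_mat A"] by simp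
  have row: "R i \<le> linf_norm_mat A" if i: "i < dim_row A" for i
  proof -
    define x where "x = vec (dim_col A) (\<lambda>j. sgn (A $$ (i, j)))"
    have x: "x \<in> U"
      by (auto simp: U_def x_def linf_norm_vec_le_iff abs_sgn_eq)
    have "R i = (A *\<^sub>v x) $ i"
      using i by (subst idx) (auto simp: x_def R_def abs_sgn intro!: sum.cong)
    also have "\<dots> \<le> linf_norm_vec (A *\<^sub>v x)"
      using abs_index_le_linf_norm_vec[of i "A *\<^sub>v x"] i by simp
    also have "\<dots> \<le> linf_norm_mat A" by (rule up[OF x])
    finally show ?thesis .
  qed
  have "M \<le> linf_norm_mat A"
    unfolding M_def using nonneg row by (subst Max_le_iff) auto
  with upper have "linf_norm_mat A = M" by (rule antisym)
  thus ?thesis by (simp only: M_def R_def)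
qed

(* Singular values of a square matrix, with multiplicity: the square roots of the eigenvalues of
   A^T A, repeated according to algebraic multiplicity. As A^T A is symmetric and positive
   semidefinite, all roots of its characteristic polynomial are real and nonnegative, so for an
   n x n matrix this multiset has n elements. *)
definition singular_values :: "real mat \<Rightarrow> real multiset" where
  "singular_values A = image_mset sqrt (proots (char_poly (transpose_mat A * A)))"

end

theory Submission
  imports Defs "Jordan_Normal_Form.Spectral_Radius"
begin

text \<open>The indicator vectors of the \<open>k\<close> blocks span a \<open>k\<close>-dimensional space of fixed vectors of \<open>S\<close>.
  On it \<open>I - T\<close> acts as \<open>-E\<close>, and the Euclidean operator norm of \<open>E\<close> is at most
  \<open>\<surd>n \<parallel>E\<parallel>\<^sub>\<infinity> = 2\<epsilon>\<surd>n\<close>. By the min-max principle for \<open>(I - T)\<^sup>T (I - T)\<close>, at least \<open>k\<close> singular values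
  of \<open>I - T\<close> are bounded by this norm.\<close>

section \<open>The Euclidean scalar product on real vectors\<close>

lemma scalar_prod_self_eq_sum_squares:
  fixes v :: "'a :: comm_semiring_1 vec"
  shows "v \<bullet> v = (\<Sum>i < dim_vec v. (v $ i)\<^sup>2)"
  by (simp add: scalar_prod_def lessThan_atLeast0 power2_eq_square)

lemma scalar_prod_self_nonneg: "0 \<le> (v :: real vec) \<bullet> v"
  by (simp add: scalar_prod_self_eq_sum_squares sum_nonneg)

lemma scalar_prod_self_pos:
  fixes v :: "real vec"
  assumes "v \<in> carrier_vec n" "v \<noteq> 0\<^sub>v n"
  shows "0 < v \<bullet> v"
proof (rule ccontr)
  assume "\<not> 0 < v \<bullet> v"
  hence "(\<Sum>i < dim_vec v. (v $ i)\<^sup>2) = 0"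
    using scalar_prod_self_nonneg[of v] by (simp add: scalar_prod_self_eq_sum_squares)
  hence "\<forall>i < dim_vec v. v $ i = 0"
    by (subst (asm) sum_nonneg_eq_0_iff) auto
  thus False using assms by auto
qed

section \<open>The spectral theorem for real symmetric matrices\<close>

lemma symmetric_scalar_prod_swap:
  fixes M :: "'a :: comm_semiring_0 mat"
  assumes "M \<in> carrier_mat n n" "M\<^sup>T = M" "x \<in> carrier_vec n" "y \<in> carrier_vec n"
  shows "x \<bullet> (M *\<^sub>v y) = y \<bullet> (M *\<^sub>v x)"
proof -
  have "x \<bullet> (M *\<^sub>v y) = (M\<^sup>T *\<^sub>v x) \<bullet> y"
    using assms by (metis transpose_vec_mult_scalar transpose_carrier_mat)
  also have "\<dots> = y \<bullet> (M *\<^sub>v x)"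
    using assms by (simp add: comm_scalar_prod[of _ n])
  finally show ?thesis .
qed

text \<open>If \<open>x + \<i>y\<close> is a complex eigenvector for \<open>a + \<i>b\<close>, then \<open>x \<bullet> My = y \<bullet> Mx\<close> becomes
  \<open>b (x \<bullet> x + y \<bullet> y) = 0\<close>, so the eigenvalue is real and \<open>x\<close> or \<open>y\<close> is a real eigenvector.\<close>

lemma real_symmetric_eigenvector:
  fixes M :: "real mat"
  assumes M: "M \<in> carrier_mat n n" and sym: "M\<^sup>T = M" and "n > 0"
  obtains e v where "v \<in> carrier_vec n" "v \<noteq> 0\<^sub>v n" "M *\<^sub>v v = e \<cdot>\<^sub>v v"
proof -
  let ?C = "map_mat complex_of_real M"
  have C: "?C \<in> carrier_mat n n" using M by simp
  from spectrum_non_empty[OF C \<open>n > 0\<close>] obtain z where "eigenvalue ?C z"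
    unfolding spectrum_def by auto
  then obtain u where "eigenvector ?C u z" unfolding eigenvalue_def by auto
  hence u: "u \<in> carrier_vec n" and u0: "u \<noteq> 0\<^sub>v n" and Cu: "?C *\<^sub>v u = z \<cdot>\<^sub>v u"
    using M by (auto simp: eigenvector_def)
  define x where "x = map_vec Re u"
  define y where "y = map_vec Im u"
  have x: "x \<in> carrier_vec n" and y: "y \<in> carrier_vec n" using u by (auto simp: x_def y_def)
  have ent: "(\<Sum>j < n. of_real (M $$ (i, j)) * u $ j) = z * u $ i" if "i < n" for i
  proof -
    have "(?C *\<^sub>v u) $ i = z * u $ i" using that u by (simp add: Cu)
    thus ?thesis using that u M by (simp add: scalar_prod_def lessThan_atLeast0)
  qed
  \<comment> \<open>As \<open>M\<close> is real, the real and imaginary parts of \<open>ent\<close>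
    split the complex eigenvalue equation into this one and \<open>My\<close>.\<close>
  have Mx: "M *\<^sub>v x = Re z \<cdot>\<^sub>v x + (- Im z) \<cdot>\<^sub>v y"
  proof (rule eq_vecI)
    fix i assume "i < dim_vec (Re z \<cdot>\<^sub>v x + (- Im z) \<cdot>\<^sub>v y)"
    hence i: "i < n" using y by simp
    show "(M *\<^sub>v x) $ i = (Re z \<cdot>\<^sub>v x + (- Im z) \<cdot>\<^sub>v y) $ i"
      using arg_cong[OF ent[OF i], of Re] i u M
      by (simp add: x_def y_def scalar_prod_def lessThan_atLeast0)
  qed (use M y in auto)
  have My: "M *\<^sub>v y = Re z \<cdot>\<^sub>v y + Im z \<cdot>\<^sub>v x"
  proof (rule eq_vecI)
    fix i assume "i < dim_vec (Re z \<cdot>\<^sub>v y + Im z \<cdot>\<^sub>v x)"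
    hence i: "i < n" using x by simp
    show "(M *\<^sub>v y) $ i = (Re z \<cdot>\<^sub>v y + Im z \<cdot>\<^sub>v x) $ i"
      using arg_cong[OF ent[OF i], of Im] i u M
      by (simp add: x_def y_def scalar_prod_def lessThan_atLeast0)
  qed (use M x in auto)
  have xy0: "x \<noteq> 0\<^sub>v n \<or> y \<noteq> 0\<^sub>v n"
  proof (rule ccontr)
    assume "\<not> ?thesis"
    hence "\<forall>i < n. x $ i = 0 \<and> y $ i = 0" by simp
    hence "u = 0\<^sub>v n" using u by (intro eq_vecI) (auto simp: x_def y_def complex_eq_iff)
    with u0 show False ..
  qed
  have "x \<bullet> (M *\<^sub>v y) = y \<bullet> (M *\<^sub>v x)"
    by (rule symmetric_scalar_prod_swap[OF M sym x y])
  hence "Re z * (x \<bullet> y) + Im z * (x \<bullet> x) = Re z * (y \<bullet> x) - Im z * (y \<bullet> y)"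
    using x y by (simp add: Mx My scalar_prod_add_distrib[of _ n])
  hence "Im z * (x \<bullet> x + y \<bullet> y) = 0"
    using x y by (simp add: comm_scalar_prod[of x n y] algebra_simps)
  moreover have "x \<bullet> x + y \<bullet> y > 0"
    using xy0 scalar_prod_self_pos[OF x] scalar_prod_self_pos[OF y]
      scalar_prod_self_nonneg[of x] scalar_prod_self_nonneg[of y] by linarith
  ultimately have "Im z = 0" by simp
  hence "M *\<^sub>v x = Re z \<cdot>\<^sub>v x" "M *\<^sub>v y = Re z \<cdot>\<^sub>v y"
    using Mx My x y by auto
  with xy0 x y that show thesis by metis
qed

lemma real_symmetric_unit_eigenvector:
  fixes M :: "real mat"
  assumes M: "M \<in> carrier_mat n n" and sym: "M\<^sup>T = M" and "n > 0"
  obtains e v where "v \<in> carrier_vec n" "v \<bullet> v = 1" "M *\<^sub>v v = e \<cdot>\<^sub>v v"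
proof -
  obtain e v where v: "v \<in> carrier_vec n" "v \<noteq> 0\<^sub>v n" "M *\<^sub>v v = e \<cdot>\<^sub>v v"
    by (rule real_symmetric_eigenvector[OF assms])
  define c where "c = inverse (sqrt (v \<bullet> v))"
  have pos: "v \<bullet> v > 0" by (rule scalar_prod_self_pos[OF v(1,2)])
  have "c * c * (v \<bullet> v) = 1"
    using pos by (simp add: c_def flip: inverse_mult_distrib)
  hence "(c \<cdot>\<^sub>v v) \<bullet> (c \<cdot>\<^sub>v v) = 1" using v by (simp add: mult.assoc)
  moreover have "M *\<^sub>v (c \<cdot>\<^sub>v v) = e \<cdot>\<^sub>v (c \<cdot>\<^sub>v v)"
    using v M by (simp add: mult_mat_vec smult_smult_assoc mult.commute)
  ultimately show thesis using that v(1) by (metis smult_carrier_vec)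
qed

text \<open>The reflection in the hyperplane orthogonal to v - e, with e the first unit vector,
  exchanges v and e because both have length 1. It replaces the completion of v to an orthonormal
  basis: the columns of \<open>H\<close> are such a basis, with v in front.\<close>

lemma householder_reflection:
  fixes v :: "real vec"
  assumes v: "v \<in> carrier_vec n" and unit: "v \<bullet> v = 1" and n: "n > 0"
  obtains H where "H \<in> carrier_mat n n" "H\<^sup>T = H" "H * H = 1\<^sub>m n" "H *\<^sub>v unit_vec n 0 = v"
proof (cases "v = unit_vec n 0")
  \<comment> \<open>The difference of the two vectors vanishes here and gives no direction to
    reflect in; the identity serves instead.\<close>
  case True
  show thesis by (rule that[of "1\<^sub>m n"]) (use True v in auto)
next
  case False
  define w where "w = v - unit_vec n 0"
  \<comment> \<open>By \<open>ww\<close> below, w \<bullet> w = 2c, so \<open>H\<close> is the usual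
    I - 2 w w^T / (w \<bullet> w).\<close>
  define c where "c = 1 - v $ 0"
  define H where "H = mat n n (\<lambda>(i, j). (if i = j then 1 else 0) - w $ i * w $ j / c)"
  have w: "w \<in> carrier_vec n" using v by (simp add: w_def)
  have w_entry: "w $ i = v $ i - (if i = 0 then 1 else 0)" if "i < n" for i
    using that v by (simp add: w_def unit_vec_def)
  have w0: "w \<noteq> 0\<^sub>v n"
  proof
    assume "w = 0\<^sub>v n"
    hence "v = unit_vec n 0"
      using v w_entry by (intro eq_vecI) (auto simp: unit_vec_def)
    with False show False ..
  qed
  have ww: "w \<bullet> w = 2 * c"
  proof -
    have "w \<bullet> w = v \<bullet> v - unit_vec n 0 \<bullet> v - (v \<bullet> unit_vec n 0 - unit_vec n 0 \<bullet> unit_vec n 0)"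
      using v by (simp add: w_def minus_scalar_prod_distrib[of _ n] scalar_prod_minus_distrib[of _ n])
    thus ?thesis using v n unit by (simp add: c_def)
  qed
  have c0: "c \<noteq> 0" using scalar_prod_self_pos[OF w w0] ww by simp
  have "H * H = 1\<^sub>m n"
  proof (rule eq_matI)
    fix i j assume "i < dim_row (1\<^sub>m n :: real mat)" "j < dim_col (1\<^sub>m n :: real mat)"
    hence i: "i < n" and j: "j < n" by auto
    have "(H * H) $$ (i, j) = (\<Sum>l < n. ((if i = l then 1 else 0) - w $ i * w $ l / c) *
        ((if l = j then 1 else 0) - w $ l * w $ j / c))"
      using i j by (simp add: H_def scalar_prod_def lessThan_atLeast0)
    \<comment> \<open>Expansion of (I - w w^T / c)^2. The conditionals are Kronecker deltas that
      collapse the sum; the quadratic term collects w \<bullet> w = 2c and thereby cancels the two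
      linear corrections.\<close>
    also have "\<dots> = (\<Sum>l < n. (if i = l then (if l = j then 1 else 0) - w $ l * w $ j / c else 0)
        - (if l = j then w $ i * w $ l / c else 0) + (w $ l * w $ l) * (w $ i * w $ j / (c * c)))"
      by (rule sum.cong) (auto simp: algebra_simps)
    also have "\<dots> = (if i = j then 1 else 0) - 2 * (w $ i * w $ j / c) + (w \<bullet> w) * (w $ i * w $ j / (c * c))"
      using i j w by (simp add: sum.distrib sum_subtractf scalar_prod_def lessThan_atLeast0
        sum_distrib_right sum_divide_distrib)
    also have "\<dots> = 1\<^sub>m n $$ (i, j)" using i j c0 by (simp add: ww)
    finally show "(H * H) $$ (i, j) = 1\<^sub>m n $$ (i, j)" .
  qed (auto simp: H_def)
  \<comment> \<open>Entry 0 of w is -c, so entry i of the image is entry i of the unit vector plus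
    that of w, which is the entry of v.\<close>
  moreover have "H *\<^sub>v unit_vec n 0 = v"
    using n v c0 by (intro eq_vecI) (auto simp: H_def w_entry c_def field_simps)
  moreover have "H\<^sup>T = H" by (auto simp: H_def)
  ultimately show thesis using that[of H] by (simp add: H_def)
qed


text \<open>Deflation, by induction on the dimension. Conjugation by a Householder reflection that
  sends the first unit vector to a unit eigenvector turns the first column into a multiple of that
  unit vector. Symmetry then clears the first row as well, and the induction hypothesis diagonalises
  the remaining symmetric block.\<close>

theorem real_symmetric_spectral_decomposition:
  fixes M :: "real mat"
  assumes "M \<in> carrier_mat n n" and "M\<^sup>T = M"
  shows "\<exists>U D. U \<in> carrier_mat n n \<and> D \<in> carrier_mat n n \<and> U\<^sup>T * U = 1\<^sub>m n \<and> U * U\<^sup>T = 1\<^sub>m n \<and>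
    diagonal_mat D \<and> M = U * D * U\<^sup>T"
  using assms
proof (induction n arbitrary: M)
  case 0
  show ?case
    by (rule exI[of _ "1\<^sub>m 0"], rule exI[of _ "0\<^sub>m 0 0"])
      (use 0 in \<open>auto simp: diagonal_mat_def\<close>)
next
  case (Suc m)
  note M = Suc.prems(1) and symM = Suc.prems(2)
  let ?n = "Suc m"
  obtain e v where v: "v \<in> carrier_vec ?n" "v \<bullet> v = 1" and ev: "M *\<^sub>v v = e \<cdot>\<^sub>v v"
    by (rule real_symmetric_unit_eigenvector[OF M symM]) auto
  obtain H where H: "H \<in> carrier_mat ?n ?n" and HT: "H\<^sup>T = H" and HH: "H * H = 1\<^sub>m ?n"
    and Hv: "H *\<^sub>v unit_vec ?n 0 = v"
    by (rule householder_reflection[OF v]) auto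
  define N where "N = H * M * H"
  define K where "K = mat m m (\<lambda>(i, j). N $$ (Suc i, Suc j))"
  define e1 where "e1 = mat 1 1 (\<lambda>_. e)"
  have N: "N \<in> carrier_mat ?n ?n" using H M by (simp add: N_def)
  have K: "K \<in> carrier_mat m m" by (simp add: K_def)
  have e1: "e1 \<in> carrier_mat 1 1" by (simp add: e1_def)
  have NT: "N\<^sup>T = N"
    using H M by (simp add: N_def transpose_mult[of _ ?n ?n _ ?n] HT symM)
  have "N *\<^sub>v unit_vec ?n 0 = H *\<^sub>v (M *\<^sub>v v)"
    using H M by (simp add: N_def Hv assoc_mult_mat_vec[of _ ?n ?n _ ?n])
  also have "\<dots> = e \<cdot>\<^sub>v ((H * H) *\<^sub>v unit_vec ?n 0)"
    using H v by (simp add: ev mult_mat_vec[of _ ?n ?n] Hv assoc_mult_mat_vec[of _ ?n ?n _ ?n])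
  finally have N_unit: "N *\<^sub>v unit_vec ?n 0 = e \<cdot>\<^sub>v unit_vec ?n 0" by (simp add: HH)
  have col0: "N $$ (i, 0) = (if i = 0 then e else 0)" if "i < ?n" for i
    using arg_cong[OF N_unit, of "\<lambda>x. x $ i"] that N by simp
  have row0: "N $$ (0, j) = (if j = 0 then e else 0)" if "j < ?n" for j
    using col0[OF that] that N arg_cong[OF NT, of "\<lambda>A. A $$ (0, j)"] by simp
  have N_block: "N = four_block_mat e1 (0\<^sub>m 1 m) (0\<^sub>m m 1) K"
    using N by (intro eq_matI) (auto simp: e1_def K_def col0 row0)
  have "K\<^sup>T = K"
  proof (rule eq_matI)
    fix i j assume "i < dim_row K" "j < dim_col K"
    hence "i < m" "j < m" by (auto simp: K_def)
    thus "K\<^sup>T $$ (i, j) = K $$ (i, j)"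
      using arg_cong[OF NT, of "\<lambda>A. A $$ (Suc i, Suc j)"] N by (simp add: K_def)
  qed (auto simp: K_def)
  from Suc.IH[OF K this] obtain P D where P: "P \<in> carrier_mat m m" and D: "D \<in> carrier_mat m m"
    and PP: "P\<^sup>T * P = 1\<^sub>m m" "P * P\<^sup>T = 1\<^sub>m m" and diag: "diagonal_mat D" and K_eq: "K = P * D * P\<^sup>T"
    by auto
  \<comment> \<open>\<open>Q\<close> lets the smaller change of basis \<open>P\<close> act on all
    coordinates but the first. As \<open>H\<close> is its own inverse, M = H N H = (H Q) D' (H Q)^T,
    which dictates the choice of \<open>U\<close>.\<close>
  define Q where "Q = four_block_mat (1\<^sub>m 1) (0\<^sub>m 1 m) (0\<^sub>m m 1) P"
  define D' where "D' = four_block_mat e1 (0\<^sub>m 1 m) (0\<^sub>m m 1) D"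
  define U where "U = H * Q"
  have Q: "Q \<in> carrier_mat ?n ?n" using P by (auto simp: Q_def intro!: carrier_matI)
  have D': "D' \<in> carrier_mat ?n ?n" using D e1 by (auto simp: D'_def intro!: carrier_matI)
  have QT: "Q\<^sup>T = four_block_mat (1\<^sub>m 1) (0\<^sub>m 1 m) (0\<^sub>m m 1) P\<^sup>T"
    unfolding Q_def using P by (subst transpose_four_block_mat[of _ 1 1 _ m _ m]) auto
  have QTQ: "Q\<^sup>T * Q = 1\<^sub>m ?n"
    unfolding QT unfolding Q_def using P
    by (subst mult_four_block_mat[of _ 1 1 _ m _ m _ _ 1 _ m])
      (auto simp: PP left_mult_zero_mat[of _ m] right_mult_zero_mat[of _ m])
  have QQT: "Q * Q\<^sup>T = 1\<^sub>m ?n"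
    unfolding QT unfolding Q_def using P
    by (subst mult_four_block_mat[of _ 1 1 _ m _ m _ _ 1 _ m])
      (auto simp: PP left_mult_zero_mat[of _ m] right_mult_zero_mat[of _ m])
  have QD: "Q * D' = four_block_mat e1 (0\<^sub>m 1 m) (0\<^sub>m m 1) (P * D)"
    unfolding Q_def D'_def using P D e1
    by (subst mult_four_block_mat[of _ 1 1 _ m _ m _ _ 1 _ m]) auto
  have "Q * D' * Q\<^sup>T = N"
    unfolding QD QT N_block K_eq using P D e1
    by (subst mult_four_block_mat[of _ 1 1 _ m _ m _ _ 1 _ m]) auto
  have UT: "U\<^sup>T = Q\<^sup>T * H"
    using H Q by (simp add: U_def transpose_mult[of _ ?n ?n _ ?n] HT)
  \<comment> \<open>Products are reassociated to the right below, so the inverse relations are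
    needed in front of a further factor.\<close>
  have H_cancel: "H * (H * A) = A" if "A \<in> carrier_mat ?n ?n" for A
    using that H by (simp add: HH flip: assoc_mult_mat[of H ?n ?n H ?n A ?n])
  have Q_cancel: "Q * (Q\<^sup>T * A) = A" if "A \<in> carrier_mat ?n ?n" for A
    using that Q by (simp add: QQT flip: assoc_mult_mat[of Q ?n ?n "Q\<^sup>T" ?n A ?n])
  have "U\<^sup>T * U = 1\<^sub>m ?n"
    unfolding UT unfolding U_def using H Q
    by (simp add: assoc_mult_mat[of _ ?n ?n _ ?n _ ?n] H_cancel QTQ)
  moreover have "U * U\<^sup>T = 1\<^sub>m ?n"
    unfolding UT unfolding U_def using H Q
    by (simp add: assoc_mult_mat[of _ ?n ?n _ ?n _ ?n] Q_cancel HH)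
  moreover have "M = U * D' * U\<^sup>T"
  proof -
    have "U * D' * U\<^sup>T = H * (Q * D' * Q\<^sup>T) * H"
      unfolding UT unfolding U_def using H Q D'
      by (simp add: assoc_mult_mat[of _ ?n ?n _ ?n _ ?n])
    also have "\<dots> = H * (H * (M * (H * H)))"
      using H M by (simp add: \<open>Q * D' * Q\<^sup>T = N\<close> N_def assoc_mult_mat[of _ ?n ?n _ ?n _ ?n])
    also have "\<dots> = M" using M H by (simp add: HH H_cancel)
    finally show ?thesis by (rule sym)
  qed
  moreover have "diagonal_mat D'"
    using diag D by (auto simp: diagonal_mat_def D'_def e1_def)
  moreover have "U \<in> carrier_mat ?n ?n" using H Q by (simp add: U_def)
  ultimately show ?case using D' by blast
qed

section \<open>Counting eigenvalues and singular values\<close>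

lemma proots_char_poly_diagonalization:
  fixes U D :: "real mat"
  assumes U: "U \<in> carrier_mat n n" and D: "D \<in> carrier_mat n n" and diag: "diagonal_mat D"
    and UU: "U\<^sup>T * U = 1\<^sub>m n" "U * U\<^sup>T = 1\<^sub>m n"
  shows "proots (char_poly (U * D * U\<^sup>T)) = mset (map (\<lambda>i. D $$ (i, i)) [0..<n])"
proof -
  have "similar_mat (U * D * U\<^sup>T) D"
    unfolding similar_mat_def similar_mat_wit_def Let_def
    by (intro exI[of _ U] exI[of _ "U\<^sup>T"]) (use U D UU in auto)
  hence "char_poly (U * D * U\<^sup>T) = char_poly D" by (rule char_poly_similar)
  also have "\<dots> = (\<Prod>a \<leftarrow> diag_mat D. [:- a, 1:])"
    using diag D by (intro char_poly_upper_triangular) (auto simp: diagonal_mat_def upper_triangular_def)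
  also have "proots \<dots> = mset (diag_mat D)"
  proof -
    have "proots (\<Prod>a \<leftarrow> as. [:- a, 1:]) = mset as" for as :: "real list"
    proof (induction as)
      case (Cons a as)
      \<comment> \<open>Roots of a product add up with multiplicity only if the product is
        nonzero.\<close>
      have "(\<Prod>a \<leftarrow> as. [:- a, 1:]) \<noteq> 0" by (auto simp: prod_list_zero_iff)
      thus ?case using Cons by (simp add: proots_mult del: mult_pCons_left)
    qed simp
    thus ?thesis .
  qed
  finally show ?thesis using D by (simp add: diag_mat_def)
qed

text \<open>Padding with zero rows makes the system square without changing its solutions, and a
  zero row makes the determinant vanish.\<close>

lemma underdetermined_system_nontrivial_solution:
  fixes A :: "'a :: field mat"
  assumes A: "A \<in> carrier_mat m k" and "m < k"
  obtains c where "c \<in> carrier_vec k" "c \<noteq> 0\<^sub>v k" "A *\<^sub>v c = 0\<^sub>v m"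
proof -
  \<comment> \<open>As m \<le> k - 1, the last row is always padding; testing for it first gives the
    shape that \<open>det_row_0\<close> expects.\<close>
  define A' where "A' = mat\<^sub>r k k (\<lambda>i. if i = k - 1 then 0\<^sub>v k else if i < m then row A i else 0\<^sub>v k)"
  have "det A' = 0"
    unfolding A'_def using A \<open>m < k\<close> by (intro det_row_0) auto
  moreover have A': "A' \<in> carrier_mat k k" by (simp add: A'_def)
  ultimately obtain c where c: "c \<in> carrier_vec k" "c \<noteq> 0\<^sub>v k" "A' *\<^sub>v c = 0\<^sub>v k"
    using det_0_iff_vec_prod_zero_field by blast
  have "A *\<^sub>v c = 0\<^sub>v m"
  proof (rule eq_vecI)
    fix i assume "i < dim_vec (0\<^sub>v m :: 'a vec)"
    hence i: "i < m" by simp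
    have "row A i = row A' i" using i A \<open>m < k\<close> by (auto simp: A'_def)
    moreover have "(A' *\<^sub>v c) $ i = 0" using c(3) i \<open>m < k\<close> by simp
    ultimately show "(A *\<^sub>v c) $ i = 0\<^sub>v m $ i" using i A A' \<open>m < k\<close> by simp
  qed (use A in simp)
  with c that show thesis by metis
qed

text \<open>One half of the Courant--Fischer theorem: with fewer than \<open>k\<close> eigenvalues below \<open>\<mu>\<close>, the
  \<open>k\<close>-dimensional column space of \<open>V\<close> would contain a nonzero vector orthogonal to all of their
  eigenvectors.\<close>

lemma count_eigenvalues_le_of_rayleigh_le:
  fixes M V :: "real mat" and \<mu> :: real
  assumes M: "M \<in> carrier_mat n n" and sym: "M\<^sup>T = M"
    and V: "V \<in> carrier_mat n k"
    and inj: "\<And>c. c \<in> carrier_vec k \<Longrightarrow> V *\<^sub>v c = 0\<^sub>v n \<Longrightarrow> c = 0\<^sub>v k"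
    and le: "\<And>c. c \<in> carrier_vec k \<Longrightarrow> (V *\<^sub>v c) \<bullet> (M *\<^sub>v (V *\<^sub>v c)) \<le> \<mu> * ((V *\<^sub>v c) \<bullet> (V *\<^sub>v c))"
  shows "k \<le> size {# x \<in># proots (char_poly M). x \<le> \<mu> #}"
proof (rule ccontr)
  obtain U D where U: "U \<in> carrier_mat n n" and D: "D \<in> carrier_mat n n"
    and UU: "U\<^sup>T * U = 1\<^sub>m n" "U * U\<^sup>T = 1\<^sub>m n" and diag: "diagonal_mat D" and M_eq: "M = U * D * U\<^sup>T"
    using real_symmetric_spectral_decomposition[OF M sym] by auto
  define ix where "ix = filter (\<lambda>i. D $$ (i, i) \<le> \<mu>) [0..<n]"
  assume "\<not> ?thesis"
  \<comment> \<open>By the diagonalisation, counting roots with algebraic multiplicity is counting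
    diagonal positions.\<close>
  also have "size {# x \<in># proots (char_poly M). x \<le> \<mu> #} = length ix"
    unfolding M_eq proots_char_poly_diagonalization[OF U D diag UU] ix_def
    by (simp only: size_mset filter_map length_map o_def flip: mset_filter)
  finally have few: "length ix < k" by simp
  \<comment> \<open>The system Ac = 0 says that Vc is orthogonal to every eigenvector with
    eigenvalue at most \<mu>. It has fewer equations than unknowns.\<close>
  define A where "A = mat (length ix) k (\<lambda>(i, j). (U\<^sup>T * V) $$ (ix ! i, j))"
  have A: "A \<in> carrier_mat (length ix) k" by (simp add: A_def)
  obtain c where c: "c \<in> carrier_vec k" and c0: "c \<noteq> 0\<^sub>v k" and Ac: "A *\<^sub>v c = 0\<^sub>v (length ix)"
    by (rule underdetermined_system_nontrivial_solution[OF A few])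
  define x where "x = V *\<^sub>v c"
  \<comment> \<open>The coordinates of \<open>x\<close> in the orthonormal eigenbasis formed by the
    columns of \<open>U\<close>.\<close>
  define y where "y = U\<^sup>T *\<^sub>v x"
  have x: "x \<in> carrier_vec n" using V c by (simp add: x_def)
  have y: "y \<in> carrier_vec n" using U x by (simp add: y_def)
  have x0: "x \<noteq> 0\<^sub>v n" using inj[OF c] c0 by (auto simp: x_def)
  have y_eq: "y = (U\<^sup>T * V) *\<^sub>v c" using U V c by (simp add: y_def x_def)
  have y_zero: "y $ i = 0" if i: "i < n" "D $$ (i, i) \<le> \<mu>" for i
  proof -
    from i have "i \<in> set ix" by (simp add: ix_def)
    then obtain j where j: "j < length ix" "ix ! j = i" by (auto simp: in_set_conv_nth)
    have "row A j = row (U\<^sup>T * V) i" using j i U V by (auto simp: A_def)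
    hence "(A *\<^sub>v c) $ j = y $ i" using j i U V A by (simp add: y_eq)
    thus ?thesis using j by (simp add: Ac)
  qed
  have xy: "x = U *\<^sub>v y"
    using U x by (simp add: y_def UU flip: assoc_mult_mat_vec[of U n n "U\<^sup>T" n])
  have yy: "y \<bullet> y = x \<bullet> x"
    using transpose_vec_mult_scalar[OF U y x] unfolding y_def[symmetric] xy[symmetric] .
  have Dy: "(D *\<^sub>v y) $ i = D $$ (i, i) * y $ i" if "i < n" for i
  proof -
    have "(D *\<^sub>v y) $ i = (\<Sum>j < n. D $$ (i, j) * y $ j)"
      using that D y by (simp add: scalar_prod_def lessThan_atLeast0)
    also have "\<dots> = (\<Sum>j < n. if j = i then D $$ (i, i) * y $ i else 0)"
      using diag D that by (intro sum.cong) (auto simp: diagonal_mat_def)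
    finally show ?thesis using that by simp
  qed
  have "x \<bullet> (M *\<^sub>v x) = x \<bullet> (U *\<^sub>v (D *\<^sub>v y))"
    using U D x by (simp add: M_eq y_def assoc_mult_mat_vec[of _ n n _ n])
  also have "\<dots> = y \<bullet> (D *\<^sub>v y)"
    using transpose_vec_mult_scalar[OF U _ x, of "D *\<^sub>v y"] D y by (simp add: y_def)
  also have "\<dots> = (\<Sum>i < n. D $$ (i, i) * (y $ i)\<^sup>2)"
    using D y Dy by (auto simp: scalar_prod_def[of y] lessThan_atLeast0 power2_eq_square intro!: sum.cong)
  finally have quad: "x \<bullet> (M *\<^sub>v x) = (\<Sum>i < n. D $$ (i, i) * (y $ i)\<^sup>2)" .
  have "0 < y \<bullet> y" using scalar_prod_self_pos[OF x x0] by (simp add: yy)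
  moreover have "y \<bullet> y = (\<Sum>i < n. (y $ i)\<^sup>2)"
    using y by (simp add: scalar_prod_self_eq_sum_squares)
  \<comment> \<open>A nonzero coordinate belongs to an eigenvalue above \<mu>, since
    \<open>y_zero\<close> kills the others. It makes the comparison of sums below strict.\<close>
  ultimately have "\<exists>i < n. y $ i \<noteq> 0" by (force intro: ccontr)
  then obtain i where i: "i < n" "y $ i \<noteq> 0" by blast
  have "\<mu> * (y \<bullet> y) = (\<Sum>i < n. \<mu> * (y $ i)\<^sup>2)"
    using y by (simp add: scalar_prod_self_eq_sum_squares sum_distrib_left)
  also have "\<dots> < (\<Sum>i < n. D $$ (i, i) * (y $ i)\<^sup>2)"
  proof (rule sum_strict_mono_ex1)
    show "\<forall>i \<in> {..<n}. \<mu> * (y $ i)\<^sup>2 \<le> D $$ (i, i) * (y $ i)\<^sup>2"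
    proof
      fix i assume "i \<in> {..<n}"
      thus "\<mu> * (y $ i)\<^sup>2 \<le> D $$ (i, i) * (y $ i)\<^sup>2"
        using y_zero[of i] by (cases "D $$ (i, i) \<le> \<mu>") (auto intro: mult_right_mono)
    qed
    show "\<exists>i \<in> {..<n}. \<mu> * (y $ i)\<^sup>2 < D $$ (i, i) * (y $ i)\<^sup>2"
      using i y_zero[of i] by (intro bexI[of _ i] mult_strict_right_mono) (auto simp: not_le[symmetric])
  qed simp
  finally have "\<mu> * (x \<bullet> x) < x \<bullet> (M *\<^sub>v x)" by (simp add: yy quad)
  with le[OF c] show False by (simp add: x_def)
qed

lemma transpose_mult_self_symmetric:
  fixes A :: "'a :: comm_semiring_0 mat"
  shows "(A\<^sup>T * A)\<^sup>T = A\<^sup>T * A"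
  by (subst transpose_mult[of _ "dim_col A" "dim_row A" _ "dim_col A"]) auto

text \<open>The quadratic form of A^T A at x is the squared length of Ax, so the eigenvalue count
  applies with \<mu> = s^2.\<close>

lemma count_singular_values_le:
  fixes A V :: "real mat" and s :: real
  assumes A: "A \<in> carrier_mat n n" and V: "V \<in> carrier_mat n k" and "s \<ge> 0"
    and inj: "\<And>c. c \<in> carrier_vec k \<Longrightarrow> V *\<^sub>v c = 0\<^sub>v n \<Longrightarrow> c = 0\<^sub>v k"
    and le: "\<And>c. c \<in> carrier_vec k \<Longrightarrow>
      (A *\<^sub>v (V *\<^sub>v c)) \<bullet> (A *\<^sub>v (V *\<^sub>v c)) \<le> s\<^sup>2 * ((V *\<^sub>v c) \<bullet> (V *\<^sub>v c))"
  shows "k \<le> size {# \<sigma> \<in># singular_values A. \<sigma> \<le> s #}"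
proof -
  have "k \<le> size {# x \<in># proots (char_poly (A\<^sup>T * A)). x \<le> s\<^sup>2 #}"
  proof (rule count_eigenvalues_le_of_rayleigh_le[OF _ transpose_mult_self_symmetric V inj])
    fix c :: "real vec" assume c: "c \<in> carrier_vec k"
    define x where "x = V *\<^sub>v c"
    have x: "x \<in> carrier_vec n" using V c by (simp add: x_def)
    have "x \<bullet> ((A\<^sup>T * A) *\<^sub>v x) = x \<bullet> (A\<^sup>T *\<^sub>v (A *\<^sub>v x))"
      using A x by (simp add: assoc_mult_mat_vec[of _ n n _ n])
    also have "\<dots> = (A *\<^sub>v x) \<bullet> (A *\<^sub>v x)"
      using transpose_vec_mult_scalar[of "A\<^sup>T" n n "A *\<^sub>v x" x] A x by simp
    finally show "(V *\<^sub>v c) \<bullet> ((A\<^sup>T * A) *\<^sub>v (V *\<^sub>v c)) \<le> s\<^sup>2 * ((V *\<^sub>v c) \<bullet> (V *\<^sub>v c))"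
      using le[OF c] by (simp add: x_def)
  qed (use A in auto)
  \<comment> \<open>For s \<ge> 0 the two predicates agree on all reals, negative ones included,
    because \<open>sqrt\<close> is strictly increasing on the whole line.\<close>
  also have "(\<lambda>x. x \<le> s\<^sup>2) = (\<lambda>x. sqrt x \<le> s)"
    using \<open>s \<ge> 0\<close> by (intro ext) (metis real_sqrt_le_iff real_sqrt_unique)
  finally show ?thesis
    by (simp add: singular_values_def filter_mset_image_mset)
qed

section \<open>Fixed vectors of the block diagonal matrix and the size of the perturbation\<close>

text \<open>The columns of \<open>V\<close> are the indicator vectors of the blocks.\<close>

lemma diag_block_stochastic_fixed_space:
  assumes "\<forall>B \<in> set Bs. stochastic_mat B \<and> 0 < dim_row B"
    and "n = sum_list (map dim_row Bs)"
  shows "\<exists>V L. V \<in> carrier_mat n (length Bs) \<and> L \<in> carrier_mat (length Bs) n \<and>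
    diag_block_mat Bs * V = V \<and> L * V = 1\<^sub>m (length Bs)"
  using assms
proof (induction Bs arbitrary: n)
  case Nil
  show ?case
    by (rule exI[of _ "0\<^sub>m 0 0"], rule exI[of _ "0\<^sub>m 0 0"]) (use Nil in auto)
next
  case (Cons B Bs)
  define m k r S where "m = sum_list (map dim_row Bs)" and "k = length Bs" and "r = dim_row B"
    and "S = diag_block_mat Bs"
  obtain V L where V: "V \<in> carrier_mat m k" and L: "L \<in> carrier_mat k m"
    and SV: "S * V = V" and LV: "L * V = 1\<^sub>m k"
    using Cons.IH[OF _ m_def] Cons.prems by (auto simp: k_def S_def)
  have n: "n = r + m" using Cons.prems by (simp add: r_def m_def)
  have B: "B \<in> carrier_mat r r" and "r > 0"
    using Cons.prems by (auto simp: stochastic_mat_def r_def)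
  have "square_mat S"
    unfolding S_def using Cons.prems by (intro diag_block_mat_square) (auto simp: stochastic_mat_def)
  hence S: "S \<in> carrier_mat m m"
    by (intro carrier_matI) (auto simp: S_def m_def dim_diag_block_mat(1))
  define u where "u = mat r 1 (\<lambda>_. 1 :: real)"
  \<comment> \<open>Reading off the first coordinate of a block inverts its all-ones column
    \<open>u\<close> from the left; this needs a nonempty block. Assembled into \<open>L\<close>,
    these rows certify that the columns of \<open>V\<close> are linearly independent.\<close>
  define l where "l = mat 1 r (\<lambda>(_, j). if j = 0 then 1 else 0 :: real)"
  have u: "u \<in> carrier_mat r 1" and l: "l \<in> carrier_mat 1 r" by (auto simp: u_def l_def)
  have Bu: "B * u = u"
    using Cons.prems B by (intro eq_matI)
      (auto simp: u_def scalar_prod_def stochastic_mat_def lessThan_atLeast0)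
  have lu: "l * u = 1\<^sub>m 1"
    using \<open>r > 0\<close> by (intro eq_matI) (auto simp: u_def l_def scalar_prod_def)
  define V' where "V' = four_block_mat u (0\<^sub>m r k) (0\<^sub>m m 1) V"
  define L' where "L' = four_block_mat l (0\<^sub>m 1 m) (0\<^sub>m k r) L"
  have block: "diag_block_mat (B # Bs) = four_block_mat B (0\<^sub>m r m) (0\<^sub>m m r) S"
    using B S by (simp add: S_def[symmetric] Let_def)
  have "diag_block_mat (B # Bs) * V' = V'"
    unfolding block V'_def using B S u V
    by (subst mult_four_block_mat[of _ r r _ m _ m _ _ 1 _ k]) (auto simp: Bu SV)
  moreover have "L' * V' = 1\<^sub>m (Suc k)"
    unfolding L'_def V'_def using l L u V
    by (subst mult_four_block_mat[of _ 1 r _ m _ k _ _ 1 _ k]) (auto simp: lu LV)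
  moreover have "V' \<in> carrier_mat n (Suc k)" "L' \<in> carrier_mat (Suc k) n"
    using u V l L unfolding V'_def L'_def n by (auto intro!: carrier_matI)
  ultimately show ?case
    unfolding length_Cons k_def[symmetric] by (intro exI[of _ V'] exI[of _ L'] conjI)
qed

text \<open>Every coordinate of x is at most its Euclidean length, so every coordinate of Ex is at
  most the maximal absolute row sum times that length. Adding n such squares gives the factor
  n.\<close>

lemma mult_mat_vec_square_le_linf_norm:
  fixes E :: "real mat"
  assumes E: "E \<in> carrier_mat n n" and x: "x \<in> carrier_vec n"
  shows "(E *\<^sub>v x) \<bullet> (E *\<^sub>v x) \<le> (linf_norm_mat E * sqrt (real n))\<^sup>2 * (x \<bullet> x)"
proof -
  have entry: "\<bar>x $ j\<bar> \<le> sqrt (x \<bullet> x)" if "j < n" for j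
  proof -
    have "(x $ j)\<^sup>2 \<le> (\<Sum>i < n. (x $ i)\<^sup>2)" using that by (intro member_le_sum) auto
    thus ?thesis using x by (intro real_le_rsqrt) (simp add: scalar_prod_self_eq_sum_squares)
  qed
  have row: "((E *\<^sub>v x) $ i)\<^sup>2 \<le> (linf_norm_mat E)\<^sup>2 * (x \<bullet> x)" if i: "i < n" for i
  proof -
    have "\<bar>(E *\<^sub>v x) $ i\<bar> \<le> (\<Sum>j < n. \<bar>E $$ (i, j)\<bar> * \<bar>x $ j\<bar>)"
      using i E x by (simp add: scalar_prod_def lessThan_atLeast0 flip: abs_mult)
    also have "\<dots> \<le> (\<Sum>j < n. \<bar>E $$ (i, j)\<bar>) * sqrt (x \<bullet> x)"
      unfolding sum_distrib_right using entry by (intro sum_mono mult_left_mono) auto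
    also have "\<dots> \<le> linf_norm_mat E * sqrt (x \<bullet> x)"
      unfolding linf_norm_mat_eq_max_row_sum using i E
      by (intro mult_right_mono Max_ge) (auto simp: scalar_prod_self_nonneg)
    finally have "((E *\<^sub>v x) $ i)\<^sup>2 \<le> (linf_norm_mat E * sqrt (x \<bullet> x))\<^sup>2"
      by (metis abs_ge_zero power2_abs power_mono)
    thus ?thesis by (simp add: power_mult_distrib scalar_prod_self_nonneg)
  qed
  have "(E *\<^sub>v x) \<bullet> (E *\<^sub>v x) \<le> (\<Sum>i < n. (linf_norm_mat E)\<^sup>2 * (x \<bullet> x))"
    using E row
    by (auto simp: scalar_prod_self_eq_sum_squares[of "E *\<^sub>v x"] simp del: sum_constant intro!: sum_mono)
  thus ?thesis by (simp add: power_mult_distrib mult_ac)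
qed

section \<open>The singular value bound for I - T\<close>

theorem theorem2p14:
  fixes S T E :: "real mat" and Bs :: "real mat list" and n k :: nat and \<epsilon> :: real
  assumes "S \<in> carrier_mat n n" and "stochastic_mat S"
    and "k \<ge> 2"
    and "length Bs = k"
    and "\<forall>B \<in> set Bs. stochastic_mat B \<and> irreducible_mat B"
    and "S = diag_block_mat Bs"
    and "E \<in> carrier_mat n n"
    and "T \<in> carrier_mat n n" and "stochastic_mat T"
    and "T = S + E"
    and "\<epsilon> = linf_norm_mat E / 2"
  shows "size {# \<sigma> \<in># singular_values (1\<^sub>m n - T). \<sigma> \<le> 2 * \<epsilon> * sqrt (real n) #} \<ge> k"
proof -
  note S = assms(1) and E = assms(7) and T = assms(8)
  have "n = sum_list (map dim_row Bs)"
    using S assms(6) by (metis carrier_matD(1) dim_diag_block_mat(1))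
  \<comment> \<open>Irreducible matrices are nonempty by definition, which supplies the positive
    dimension of each block.\<close>
  with diag_block_stochastic_fixed_space[of Bs n] assms(4-6)
  obtain V L where V: "V \<in> carrier_mat n k" and L: "L \<in> carrier_mat k n"
    and SV: "S * V = V" and LV: "L * V = 1\<^sub>m k"
    by (auto simp: irreducible_mat_def)
  have "linf_norm_mat E \<ge> 0"
    by (simp add: linf_norm_mat_eq_max_row_sum)
  show ?thesis
  \<comment> \<open>The threshold 2 \<epsilon> \<open>sqrt (real n)\<close> is
    \<open>linf_norm_mat E * sqrt (real n)\<close>, the bound on how much \<open>E\<close> stretches
    Euclidean length.\<close>
  proof (rule count_singular_values_le[OF _ V])
    show "1\<^sub>m n - T \<in> carrier_mat n n" using T by (rule minus_carrier_mat)
    show "0 \<le> 2 * \<epsilon> * sqrt (real n)"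
      using \<open>linf_norm_mat E \<ge> 0\<close> by (simp add: assms(11))
  next
    fix c :: "real vec" assume c: "c \<in> carrier_vec k" and "V *\<^sub>v c = 0\<^sub>v n"
    \<comment> \<open>The left inverse \<open>L\<close> recovers c from Vc.\<close>
    hence "(L * V) *\<^sub>v c = L *\<^sub>v 0\<^sub>v n" using L V by simp
    also have "\<dots> = 0\<^sub>v k" using L by (intro eq_vecI) auto
    finally have "(L * V) *\<^sub>v c = 0\<^sub>v k" .
    thus "c = 0\<^sub>v k" using c by (simp add: LV)
  next
    fix c :: "real vec" assume c: "c \<in> carrier_vec k"
    define x where "x = V *\<^sub>v c"
    have x: "x \<in> carrier_vec n" using V c by (simp add: x_def)
    have "S *\<^sub>v x = (S * V) *\<^sub>v c" using S V c by (simp add: x_def)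
    hence Sx: "S *\<^sub>v x = x" by (simp add: SV x_def)
    have Ax: "(1\<^sub>m n - T) *\<^sub>v x = - (E *\<^sub>v x)"
    proof -
      have "(1\<^sub>m n - T) *\<^sub>v x = x - (S *\<^sub>v x + E *\<^sub>v x)"
        using S E x by (simp add: assms(10) minus_mult_distrib_mat_vec[of _ n n]
          add_mult_distrib_mat_vec[of _ n n])
      also have "\<dots> = - (E *\<^sub>v x)" using E x by (intro eq_vecI) (auto simp: Sx)
      finally show ?thesis .
    qed
    have "((1\<^sub>m n - T) *\<^sub>v x) \<bullet> ((1\<^sub>m n - T) *\<^sub>v x) = (E *\<^sub>v x) \<bullet> (E *\<^sub>v x)"
      using E x by (simp add: Ax)
    also have "\<dots> \<le> (linf_norm_mat E * sqrt (real n))\<^sup>2 * (x \<bullet> x)"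
      by (rule mult_mat_vec_square_le_linf_norm[OF E x])
    finally show "((1\<^sub>m n - T) *\<^sub>v (V *\<^sub>v c)) \<bullet> ((1\<^sub>m n - T) *\<^sub>v (V *\<^sub>v c))
        \<le> (2 * \<epsilon> * sqrt (real n))\<^sup>2 * ((V *\<^sub>v c) \<bullet> (V *\<^sub>v c))"
      by (simp add: x_def assms(11))
  qed
qed

end
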